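(* Let $\mathbb{F}$ be $\mathbb{R}$ or $\mathbb{C}$, and let $p\ge1$. For each $j=1,\dots,p$ let $U(j),V(j),W(j)$ be $k(j)^2\times t(j)$ matrices over $\mathbb{F}$ that determine a bilinear non-commutative algorithm for multiplying $k(j)\times k(j)$ matrices, and let $n=\prod_{j=1}^p k(j)$. The recursive bilinear non-commutative algorithm for multiplying $n\times n$ matrices based on non-stationary partitioning, which uses $k(j),U(j),V(j),W(j)$ at recursion level $j$, is stable: executed in rounded arithmetic with machine precision $\varepsilon$, it satisfies, for all $n\times n$ matrices $A,B$ over $\mathbb{F}$ with exact product $C=AB$ and computed output $C_{comp}$, $$\|C_{comp}-C\|\le\mu(n)\,\varepsilon\,\|A\|\,\|B\|+O(\varepsilon^2),$$ where $\|M\|=\max_{i,j}|m_{ij}|$ is the maximum-entry norm and $$\mu(n)=\Bigl(1+\sum_{j}\max_{r,s}\bigl(\alpha_s(j)+\beta_s(j)+\gamma_r(j)+3\bigr)\Bigr)\Bigl(\prod_{j}\mathrm{emax}(j)\,\|U(j)\|\,\|V(j)\|\,\|W(j)\|\Bigr),$$ with $j$ ranging over $1,\dots,p$.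
   Context: Rounded arithmetic: every execution of an operation $op\in\{+,-,\cdot\}$ (including multiplication by an entry of $U(j)$, $V(j)$ or $W(j)$) on operands $a,b\in\mathbb{F}$ returns $op(a,b)(1+\theta)$ with $|\theta|\le\varepsilon$, $\theta$ otherwise arbitrary and possibly different at each execution. The term $O(\varepsilon^2)$ refers to $\varepsilon\to0$ with $n$, $A$, $B$ and the algorithm fixed, uniformly over all choices of the errors $\theta$. Bilinear non-commutative algorithm for $k\times k$ matrices: $k^2\times t$ matrices $U=(u_{is}),V=(v_{js}),W=(w_{rs})$ such that, for non-commuting entries (so that entries may be replaced by square matrix blocks), the product $C=AB$ of $k\times k$ matrices is given by $$c_{hl}=\sum_{s=1}^t w_{rs}P_s,\qquad P_s=\Bigl(\sum_{i=1}^{k^2}u_{is}x_i\Bigr)\Bigl(\sum_{j=1}^{k^2}v_{js}y_j\Bigr),\qquad r=k(h-1)+l,\quad h,l=1,\dots,k,$$ where $x_i$ (resp. $y_j$) are the entries of $A$ (resp. $B$) ordered column-wise. Recursive algorithm: at recursion level $j$ ($j=1$ is the outermost), the two matrices to be multiplied have order $\prod_{l\ge j}k(l)$; each is partitioned into $k(j)\times k(j)$ equal square blocks, and the formulas above with $k=k(j)$, $t=t(j)$, $U=U(j)$, $V=V(j)$, $W=W(j)$ are applied to the blocks ordered column-wise, the $t(j)$ block products $P_s$ being computed recursively at level $j+1$; after level $p$ the products are $1\times1$ scalar multiplications. In each linear combination only the terms with nonzero coefficients are used; each such term is multiplied by its coefficient, and the resulting $m$ terms are added by balanced pairwise summation (recursively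 adding the sum of the first $\lceil m/2\rceil$ terms and the sum of the remaining terms), so each term passes through at most $\lceil\log_2m\rceil$ additions. Quantities at level $j$ (written without the argument $j$; all are computed from $U(j),V(j),W(j)$): $a_s=\#\{i:u_{is}\ne0\}$, $b_s=\#\{i:v_{is}\neq0\}$, $c_r=\#\{s:w_{rs}\neq0\}$; $\alpha_s=\lceil\log_2a_s\rceil$, $\beta_s=\lceil\log_2b_s\rceil$, $\gamma_r=\lceil\log_2c_r\rceil$ (with $\lceil\log_20\rceil$ read as $0$); $\xi_{rs}=1$ if $w_{rs}\neq0$ and $0$ otherwise; $\mathrm{e}_r=\sum_{s}a_sb_s\xi_{rs}$; $\mathrm{emax}=\max_r\mathrm{e}_r$. *)

theory Defs
  imports "Jordan_Normal_Form.Matrix" "HOL-Library.Landau_Symbols"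
begin

text \<open>
  All indices of matrices, blocks and products are 0-based; the recursion levels are
  \<open>1, \<dots>, p\<close>. The scalars have a type of class \<^class>\<open>real_normed_field\<close>, whose norm is
  multiplicative; up to isometric isomorphism its members are the real and the complex numbers.
\<close>

definition max_norm :: "'a::real_normed_field mat \<Rightarrow> real" where
  "max_norm M = Max (norm ` elements_mat M)"


subsection \<open>Bilinear non-commutative algorithms\<close>

definition lincomb_mat ::
    "nat \<Rightarrow> nat \<Rightarrow> (nat \<Rightarrow> 'a) \<Rightarrow> (nat \<Rightarrow> 'a mat) \<Rightarrow> 'a::real_normed_field mat" where
  "lincomb_mat m q c X = mat m m (\<lambda>(a, b). \<Sum>i<q. c i * X i $$ (a, b))"

text \<open>
  The entries of the two factors are arbitrary square blocks of a common order \<open>m\<close>. Column-wise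
  position \<open>i\<close> is the entry in row \<open>i mod k\<close> and column \<open>i div k\<close>, whereas the
  rows of \<open>W\<close> number the entries of the product row by row.
\<close>

definition bilinear_noncomm_algorithm ::
    "nat \<Rightarrow> nat \<Rightarrow> 'a::real_normed_field mat \<Rightarrow> 'a mat \<Rightarrow> 'a mat \<Rightarrow> bool" where
  "bilinear_noncomm_algorithm k t U V W \<longleftrightarrow>
     U \<in> carrier_mat (k\<^sup>2) t \<and> V \<in> carrier_mat (k\<^sup>2) t \<and> W \<in> carrier_mat (k\<^sup>2) t \<and>
     (\<forall>m. \<forall>X Y :: nat \<Rightarrow> nat \<Rightarrow> 'a mat.
        (\<forall>h<k. \<forall>l<k. X h l \<in> carrier_mat m m \<and> Y h l \<in> carrier_mat m m) \<longrightarrow>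
        (let P = (\<lambda>s. lincomb_mat m (k\<^sup>2) (\<lambda>i. U $$ (i, s)) (\<lambda>i. X (i mod k) (i div k)) *
                      lincomb_mat m (k\<^sup>2) (\<lambda>i. V $$ (i, s)) (\<lambda>i. Y (i mod k) (i div k)))
         in \<forall>h<k. \<forall>l<k.
              mat m m (\<lambda>e. \<Sum>q<k. (X h q * Y q l) $$ e) =
              lincomb_mat m t (\<lambda>s. W $$ (k * h + l, s)) P))"


subsection \<open>Rounded arithmetic\<close>

text \<open>\<open>rounded \<epsilon> x\<close> is the set of all possible results of an operation with exact value \<open>x\<close>.\<close>

definition rounded :: "real \<Rightarrow> 'a::real_normed_field \<Rightarrow> 'a set" where
  "rounded \<epsilon> x = {x * (1 + \<theta>) | \<theta>. norm \<theta> \<le> \<epsilon>}"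

definition rounded_add :: "real \<Rightarrow> 'a::real_normed_field mat \<Rightarrow> 'a mat \<Rightarrow> 'a mat set" where
  "rounded_add \<epsilon> X Y = {Z \<in> carrier_mat (dim_row X) (dim_col X).
     \<forall>a<dim_row X. \<forall>b<dim_col X. Z $$ (a, b) \<in> rounded \<epsilon> (X $$ (a, b) + Y $$ (a, b))}"

definition rounded_smult :: "real \<Rightarrow> 'a::real_normed_field \<Rightarrow> 'a mat \<Rightarrow> 'a mat set" where
  "rounded_smult \<epsilon> c X = {Z \<in> carrier_mat (dim_row X) (dim_col X).
     \<forall>a<dim_row X. \<forall>b<dim_col X. Z $$ (a, b) \<in> rounded \<epsilon> (c * X $$ (a, b))}"

text \<open>\<open>(length Xs + 1) div 2\<close> is half the number of terms, rounded up.\<close>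

inductive pairwise_sum :: "real \<Rightarrow> nat \<Rightarrow> 'a::real_normed_field mat list \<Rightarrow> 'a mat \<Rightarrow> bool"
  for \<epsilon> :: real and m :: nat where
  empty: "pairwise_sum \<epsilon> m [] (0\<^sub>m m m)"
| single: "pairwise_sum \<epsilon> m [X] X"
| split: "2 \<le> length Xs \<Longrightarrow>
    pairwise_sum \<epsilon> m (take ((length Xs + 1) div 2) Xs) Y \<Longrightarrow>
    pairwise_sum \<epsilon> m (drop ((length Xs + 1) div 2) Xs) Z \<Longrightarrow>
    S \<in> rounded_add \<epsilon> Y Z \<Longrightarrow>
    pairwise_sum \<epsilon> m Xs S"

definition rounded_lincomb ::
    "real \<Rightarrow> nat \<Rightarrow> nat \<Rightarrow> (nat \<Rightarrow> 'a) \<Rightarrow> (nat \<Rightarrow> 'a mat) \<Rightarrow> 'a::real_normed_field mat \<Rightarrow> bool" where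
  "rounded_lincomb \<epsilon> m q c X S \<longleftrightarrow>
     (\<exists>Ts. list_all2 (\<lambda>i T. T \<in> rounded_smult \<epsilon> (c i) (X i)) (filter (\<lambda>i. c i \<noteq> 0) [0..<q]) Ts \<and>
           pairwise_sum \<epsilon> m Ts S)"


subsection \<open>The recursive algorithm\<close>

definition block :: "nat \<Rightarrow> 'a mat \<Rightarrow> nat \<Rightarrow> nat \<Rightarrow> 'a mat" where
  "block m A h l = mat m m (\<lambda>(a, b). A $$ (h * m + a, l * m + b))"

text \<open>
  \<open>recursive_product \<epsilon> p k t U V W j A B C\<close>: some execution in rounded arithmetic, started at
  recursion level \<open>j\<close> on \<open>A\<close> and \<open>B\<close>, outputs \<open>C\<close>.
\<close>

inductive recursive_product ::
    "real \<Rightarrow> nat \<Rightarrow> (nat \<Rightarrow> nat) \<Rightarrow> (nat \<Rightarrow> nat) \<Rightarrow>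
     (nat \<Rightarrow> 'a mat) \<Rightarrow> (nat \<Rightarrow> 'a mat) \<Rightarrow> (nat \<Rightarrow> 'a mat) \<Rightarrow>
     nat \<Rightarrow> 'a::real_normed_field mat \<Rightarrow> 'a mat \<Rightarrow> 'a mat \<Rightarrow> bool"
  for \<epsilon> :: real and p :: nat and k t :: "nat \<Rightarrow> nat" and U V W :: "nat \<Rightarrow> 'a mat" where
  scalar: "A \<in> carrier_mat 1 1 \<Longrightarrow> B \<in> carrier_mat 1 1 \<Longrightarrow> C \<in> carrier_mat 1 1 \<Longrightarrow>
    C $$ (0, 0) \<in> rounded \<epsilon> (A $$ (0, 0) * B $$ (0, 0)) \<Longrightarrow>
    recursive_product \<epsilon> p k t U V W (Suc p) A B C"
| level: "j \<le> p \<Longrightarrow> m = (\<Prod>i=Suc j..p. k i) \<Longrightarrow>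
    A \<in> carrier_mat (k j * m) (k j * m) \<Longrightarrow>
    B \<in> carrier_mat (k j * m) (k j * m) \<Longrightarrow>
    C \<in> carrier_mat (k j * m) (k j * m) \<Longrightarrow>
    \<forall>s<t j. rounded_lincomb \<epsilon> m ((k j)\<^sup>2) (\<lambda>i. U j $$ (i, s))
              (\<lambda>i. block m A (i mod k j) (i div k j)) (L s) \<Longrightarrow>
    \<forall>s<t j. rounded_lincomb \<epsilon> m ((k j)\<^sup>2) (\<lambda>i. V j $$ (i, s))
              (\<lambda>i. block m B (i mod k j) (i div k j)) (R s) \<Longrightarrow>
    \<forall>s<t j. recursive_product \<epsilon> p k t U V W (Suc j) (L s) (R s) (P s) \<Longrightarrow>
    \<forall>h<k j. \<forall>l<k j. rounded_lincomb \<epsilon> m (t j) (\<lambda>s. W j $$ (k j * h + l, s)) P (block m C h l) \<Longrightarrow>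
    recursive_product \<epsilon> p k t U V W j A B C"


subsection \<open>The stability factor\<close>

definition ceil_log2 :: "nat \<Rightarrow> nat" where
  "ceil_log2 x = (if x = 0 then 0 else nat \<lceil>log 2 (real x)\<rceil>)"

definition col_nnz :: "'a::zero mat \<Rightarrow> nat \<Rightarrow> nat" where
  "col_nnz M s = card {i. i < dim_row M \<and> M $$ (i, s) \<noteq> 0}"

definition row_nnz :: "'a::zero mat \<Rightarrow> nat \<Rightarrow> nat" where
  "row_nnz M r = card {s. s < dim_col M \<and> M $$ (r, s) \<noteq> 0}"

text \<open>
  In the notation \<open>a\<^sub>s, b\<^sub>s, c\<^sub>r\<close> for the numbers of nonzero coefficients one has
  \<open>a\<^sub>s = col_nnz U s\<close>, \<open>b\<^sub>s = col_nnz V s\<close>, \<open>c\<^sub>r = row_nnz W r\<close>, and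
  \<open>\<alpha>\<^sub>s, \<beta>\<^sub>s, \<gamma>\<^sub>r\<close> are their rounded-up binary logarithms.
\<close>

definition level_ops :: "'a::zero mat \<Rightarrow> 'a mat \<Rightarrow> 'a mat \<Rightarrow> nat" where
  "level_ops U V W = Max ((\<lambda>(r, s). ceil_log2 (col_nnz U s) + ceil_log2 (col_nnz V s) +
     ceil_log2 (row_nnz W r) + 3) ` ({..<dim_row W} \<times> {..<dim_col W}))"

definition e_row :: "'a::zero mat \<Rightarrow> 'a mat \<Rightarrow> 'a mat \<Rightarrow> nat \<Rightarrow> nat" where
  "e_row U V W r =
     (\<Sum>s<dim_col W. col_nnz U s * col_nnz V s * (if W $$ (r, s) \<noteq> 0 then 1 else 0))"

definition emax :: "'a::zero mat \<Rightarrow> 'a mat \<Rightarrow> 'a mat \<Rightarrow> nat" where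
  "emax U V W = Max (e_row U V W ` {..<dim_row W})"

definition stability_factor ::
    "nat \<Rightarrow> (nat \<Rightarrow> 'a::real_normed_field mat) \<Rightarrow> (nat \<Rightarrow> 'a mat) \<Rightarrow> (nat \<Rightarrow> 'a mat) \<Rightarrow> real" where
  "stability_factor p U V W =
     (1 + (\<Sum>j=1..p. real (level_ops (U j) (V j) (W j)))) *
     (\<Prod>j=1..p. real (emax (U j) (V j) (W j)) *
        max_norm (U j) * max_norm (V j) * max_norm (W j))"


subsection \<open>Every pair of inputs has an execution\<close>

lemma self_in_rounded: "0 \<le> \<epsilon> \<Longrightarrow> x \<in> rounded \<epsilon> x"
  unfolding rounded_def by (rule CollectI, rule exI[of _ 0]) simp

lemma pairwise_sum_exists:
  assumes "0 \<le> \<epsilon>" and "\<forall>X\<in>set Xs. X \<in> carrier_mat m m"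
  shows "\<exists>S \<in> carrier_mat m m. pairwise_sum \<epsilon> m Xs S"
  using assms(2)
proof (induction Xs rule: length_induct)
  case (1 Xs)
  let ?h = "(length Xs + 1) div 2"
  consider "Xs = []" | X where "Xs = [X]" | "2 \<le> length Xs"
    by (metis One_nat_def Suc_1 Suc_leI length_0_conv length_Suc_conv less_one linorder_neqE_nat not_less_eq)
  then show ?case
  proof cases
    case 1
    then show ?thesis using pairwise_sum.empty by (intro bexI[of _ "0\<^sub>m m m"]) auto
  next
    case 2
    then show ?thesis using pairwise_sum.single "1.prems" by auto
  next
    case 3
    have "length (take ?h Xs) < length Xs" "length (drop ?h Xs) < length Xs"
      using 3 by auto
    moreover have "\<forall>X\<in>set (take ?h Xs). X \<in> carrier_mat m m" "\<forall>X\<in>set (drop ?h Xs). X \<in> carrier_mat m m"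
      using "1.prems" by (auto dest: in_set_takeD in_set_dropD)
    ultimately obtain Y Z where Y: "Y \<in> carrier_mat m m" "pairwise_sum \<epsilon> m (take ?h Xs) Y"
      and Z: "Z \<in> carrier_mat m m" "pairwise_sum \<epsilon> m (drop ?h Xs) Z"
      using "1.IH" by meson
    have "Y + Z \<in> rounded_add \<epsilon> Y Z"
      unfolding rounded_add_def using Y Z assms(1) by (auto intro: self_in_rounded)
    then show ?thesis using pairwise_sum.split[OF 3 Y(2) Z(2)] Y Z
      by (intro bexI[of _ "Y + Z"]) auto
  qed
qed

lemma rounded_lincomb_exists:
  assumes "0 \<le> \<epsilon>" and "\<And>i. i < q \<Longrightarrow> X i \<in> carrier_mat m m"
  shows "\<exists>S \<in> carrier_mat m m. rounded_lincomb \<epsilon> m q c X S"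
proof -
  let ?I = "filter (\<lambda>i. c i \<noteq> 0) [0..<q]"
  let ?Ts = "map (\<lambda>i. c i \<cdot>\<^sub>m X i) ?I"
  have "list_all2 (\<lambda>i T. T \<in> rounded_smult \<epsilon> (c i) (X i)) ?I ?Ts"
    unfolding list_all2_map2 rounded_smult_def
    by (rule list.rel_refl_strong) (auto intro: self_in_rounded assms(1))
  moreover have "\<forall>T\<in>set ?Ts. T \<in> carrier_mat m m"
    using assms(2) by auto
  ultimately show ?thesis
    using pairwise_sum_exists[OF assms(1)] unfolding rounded_lincomb_def by blast
qed

lemma recursive_product_exists:
  fixes A B :: "'a::real_normed_field mat"
  assumes "0 \<le> \<epsilon>" and "j \<le> Suc p"
    and "A \<in> carrier_mat (\<Prod>i=j..p. k i) (\<Prod>i=j..p. k i)"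
    and "B \<in> carrier_mat (\<Prod>i=j..p. k i) (\<Prod>i=j..p. k i)"
  shows "\<exists>C \<in> carrier_mat (\<Prod>i=j..p. k i) (\<Prod>i=j..p. k i). recursive_product \<epsilon> p k t U V W j A B C"
  using assms(2-4)
proof (induction arbitrary: A B rule: inc_induct)
  case base
  then have AB: "A \<in> carrier_mat 1 1" "B \<in> carrier_mat 1 1" by simp_all
  then have "(A * B) $$ (0, 0) = A $$ (0, 0) * B $$ (0, 0)" by (simp add: scalar_prod_def)
  then have "recursive_product \<epsilon> p k t U V W (Suc p) A B (A * B)"
    using AB self_in_rounded[OF assms(1)] by (intro recursive_product.scalar) simp_all
  then show ?case using AB by (intro bexI[of _ "A * B"]) simp_all
next
  case (step j)
  define m where "m = (\<Prod>i=Suc j..p. k i)"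
  have N: "(\<Prod>i=j..p. k i) = k j * m"
    using step.hyps unfolding m_def by (simp add: prod.atLeast_Suc_atMost)
  have ex: "\<exists>S \<in> carrier_mat m m. rounded_lincomb \<epsilon> m q c (\<lambda>i. block m X (f i) (g i)) S"
    for q c f g and X :: "'a mat"
    by (rule rounded_lincomb_exists[OF assms(1)]) (simp add: block_def)
  have "\<exists>S \<in> carrier_mat m m. rounded_lincomb \<epsilon> m ((k j)\<^sup>2) (\<lambda>i. U j $$ (i, s))
              (\<lambda>i. block m A (i mod k j) (i div k j)) S" for s
    by (rule ex)
  then obtain L where L: "\<And>s. L s \<in> carrier_mat m m"
      "\<And>s. rounded_lincomb \<epsilon> m ((k j)\<^sup>2) (\<lambda>i. U j $$ (i, s))
              (\<lambda>i. block m A (i mod k j) (i div k j)) (L s)"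
    by metis
  have "\<exists>S \<in> carrier_mat m m. rounded_lincomb \<epsilon> m ((k j)\<^sup>2) (\<lambda>i. V j $$ (i, s))
              (\<lambda>i. block m B (i mod k j) (i div k j)) S" for s
    by (rule ex)
  then obtain R where R: "\<And>s. R s \<in> carrier_mat m m"
      "\<And>s. rounded_lincomb \<epsilon> m ((k j)\<^sup>2) (\<lambda>i. V j $$ (i, s))
              (\<lambda>i. block m B (i mod k j) (i div k j)) (R s)"
    by metis
  have "\<exists>P. P \<in> carrier_mat m m \<and> recursive_product \<epsilon> p k t U V W (Suc j) (L s) (R s) P" for s
    using step.IH[of "L s" "R s"] L R unfolding m_def by blast
  then obtain P where P: "\<And>s. P s \<in> carrier_mat m m"
      "\<And>s. recursive_product \<epsilon> p k t U V W (Suc j) (L s) (R s) (P s)"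
    by metis
  have "\<exists>S \<in> carrier_mat m m. rounded_lincomb \<epsilon> m (t j) (\<lambda>s. W j $$ (k j * h + l, s)) P S" for h l
    by (rule rounded_lincomb_exists[OF assms(1)]) (rule P(1))
  then obtain D where D: "\<And>h l. D h l \<in> carrier_mat m m"
      "\<And>h l. rounded_lincomb \<epsilon> m (t j) (\<lambda>s. W j $$ (k j * h + l, s)) P (D h l)"
    by metis
  define C where "C = mat (k j * m) (k j * m) (\<lambda>(a, b). D (a div m) (b div m) $$ (a mod m, b mod m))"
  have "block m C h l = D h l" if "h < k j" "l < k j" for h l
  proof (rule eq_matI)
    show "dim_row (block m C h l) = dim_row (D h l)" "dim_col (block m C h l) = dim_col (D h l)"
      using D(1)[of h l] by (auto simp: block_def)
    fix a b assume "a < dim_row (D h l)" "b < dim_col (D h l)"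
    then have ab: "a < m" "b < m" using D(1)[of h l] by auto
    have "h * m + a < k j * m" if "h < k j" "a < m" for h a
    proof -
      have "h * m + a < Suc h * m" using that by simp
      also have "\<dots> \<le> k j * m" using that by (intro mult_right_mono) auto
      finally show ?thesis .
    qed
    then show "block m C h l $$ (a, b) = D h l $$ (a, b)"
      using ab that by (simp add: block_def C_def)
  qed
  then have "\<forall>h<k j. \<forall>l<k j. rounded_lincomb \<epsilon> m (t j) (\<lambda>s. W j $$ (k j * h + l, s)) P (block m C h l)"
    using D(2) by auto
  then have "recursive_product \<epsilon> p k t U V W j A B C"
    using step.hyps step.prems L(2) R(2) P(2) unfolding N
    by (intro recursive_product.level[where m = m and L = L and R = R and P = P]) (auto simp: m_def C_def)
  then show ?case unfolding N by (intro bexI[of _ C]) (auto simp: C_def)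
qed

end

theory Submission
  imports Defs
begin

text \<open>
  At every level the entrywise error obeys an exact bound: with \<open>norm A \<le> a\<close> and \<open>norm B \<le> b\<close>,
  an execution started at level \<open>j\<close> satisfies \<open>norm (C - A B) \<le> ((1 + \<epsilon>)^N - 1) E a b\<close>, where
  \<open>N\<close> is one plus the sum of \<open>level_ops\<close> over the remaining levels and \<open>E\<close> is the product of
  \<open>emax \<parallel>U\<parallel> \<parallel>V\<parallel> \<parallel>W\<parallel>\<close> over these levels. Relative errors \<open>g - 1\<close>, \<open>h - 1\<close> of successive stages
  compose to \<open>g h - 1\<close>, so the exponents add up. Multiplying perturbed \<open>m \<times> m\<close> factors costs a
  factor \<open>m\<close>, which is absorbed by \<open>E\<close>: evaluating a correct algorithm on all-ones matrices
  shows \<open>k \<le> emax \<parallel>U\<parallel> \<parallel>V\<parallel> \<parallel>W\<parallel>\<close>. Finally, \<open>(1 + \<epsilon>)^N - 1 = N \<epsilon> + O(\<epsilon>\<^sup>2)\<close>.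
\<close>

section \<open>Maximum-entry norm and rounded-up binary logarithm\<close>

lemma norm_entry_le_max_norm:
  assumes "i < dim_row M" "j < dim_col M"
  shows "norm (M $$ (i, j)) \<le> max_norm M"
proof -
  have "M $$ (i, j) \<in> elements_mat M"
    using assms by auto
  moreover have "finite (elements_mat M)"
    unfolding elements_mat_def by simp
  ultimately show ?thesis
    unfolding max_norm_def by (intro Max_ge) auto
qed

lemma max_norm_le:
  assumes "0 < dim_row M" "0 < dim_col M"
    and "\<And>i j. i < dim_row M \<Longrightarrow> j < dim_col M \<Longrightarrow> norm (M $$ (i, j)) \<le> c"
  shows "max_norm M \<le> c"
proof -
  have "M $$ (0, 0) \<in> elements_mat M"
    using assms(1,2) by auto
  moreover have "finite (elements_mat M)"
    unfolding elements_mat_def by simp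
  ultimately show ?thesis
    unfolding max_norm_def using assms(3) by (subst Max_le_iff) (auto simp: elements_mat_def)
qed

text \<open>This identifies \<open>ceil_log2 x\<close> as the least exponent \<open>d\<close> with
  \<open>x\<close> at most \<open>2 ^ d\<close>, so that real logarithms are avoided from here on.
  The value 0 at \<open>x = 0\<close> fits, since \<open>0 \<le> 2 ^ d\<close> for every
  \<open>d\<close>.\<close>

lemma ceil_log2_le_iff: "ceil_log2 x \<le> d \<longleftrightarrow> x \<le> 2 ^ d"
proof (cases "x = 0")
  case False
  have "ceil_log2 x \<le> d \<longleftrightarrow> log 2 (real x) \<le> real d"
    using False by (simp add: ceil_log2_def ceiling_le_iff)
  also have "\<dots> \<longleftrightarrow> real x \<le> 2 powr real d"
    using False by (subst log_le_iff) auto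
  also have "\<dots> \<longleftrightarrow> real x \<le> real (2 ^ d)"
    by (simp add: powr_realpow)
  finally show ?thesis by (simp only: of_nat_le_iff)
qed (simp add: ceil_log2_def)

lemma ceil_log2_mono: "x \<le> y \<Longrightarrow> ceil_log2 x \<le> ceil_log2 y"
  using ceil_log2_le_iff[of y "ceil_log2 y"] by (simp add: ceil_log2_le_iff)

text \<open>Halving with rounding up lowers the exponent by at least one, since
  \<open>2 ^ Suc d\<close> is even. The gained unit pays for the addition that joins two partial
  sums.\<close>

lemma Suc_ceil_log2_half:
  assumes "2 \<le> x"
  shows "Suc (ceil_log2 ((x + 1) div 2)) \<le> ceil_log2 x"
proof -
  have x: "x \<le> 2 ^ ceil_log2 x"
    using ceil_log2_le_iff by blast
  then obtain d where d: "ceil_log2 x = Suc d"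
    using assms by (cases "ceil_log2 x") auto
  have "(x + 1) div 2 \<le> 2 ^ d"
    using x unfolding d by simp
  then show ?thesis
    using d by (simp add: ceil_log2_le_iff)
qed

section \<open>Composition of relative errors\<close>

lemma rounded_error:
  assumes "y \<in> rounded \<epsilon> x"
  shows "norm (y - x) \<le> \<epsilon> * norm x"
proof -
  obtain \<theta> where \<theta>: "y = x * (1 + \<theta>)" "norm \<theta> \<le> \<epsilon>"
    using assms unfolding rounded_def by auto
  have "y - x = \<theta> * x" using \<theta>(1) by (simp add: algebra_simps)
  then show ?thesis using \<theta>(2) by (simp add: norm_mult mult_right_mono)
qed

text \<open>Errors are measured against a bound \<open>c\<close> of the exact value instead of its
  norm, which may be much smaller because of cancellation.\<close>

lemma norm_le_of_rel_error:
  fixes x y :: "'a::real_normed_vector"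
  assumes "norm (y - x) \<le> (g - 1) * c" and "norm x \<le> c"
  shows "norm y \<le> g * c"
proof -
  have "norm y \<le> norm (y - x) + norm x"
    using norm_triangle_ineq[of "y - x" x] by simp
  then show ?thesis using assms by (simp add: algebra_simps)
qed

text \<open>The second stage acts on a value of norm at most \<open>g * c\<close>, and
  \<open>(h - 1) * g + (g - 1) = g * h - 1\<close>.\<close>

lemma rel_error_trans:
  fixes x y z :: "'a::real_normed_vector"
  assumes "norm (y - x) \<le> (g - 1) * c" and "norm x \<le> c"
    and "norm (z - y) \<le> (h - 1) * norm y" and "1 \<le> h"
  shows "norm (z - x) \<le> (g * h - 1) * c"
proof -
  have "norm (z - x) \<le> norm (z - y) + norm (y - x)"
    using norm_triangle_ineq[of "z - y" "y - x"] by simp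
  also have "\<dots> \<le> (h - 1) * (g * c) + (g - 1) * c"
    using assms norm_le_of_rel_error[OF assms(1,2)]
    by (intro add_mono order_trans[OF assms(3)] mult_left_mono) auto
  finally show ?thesis by (simp add: algebra_simps)
qed

section \<open>Rounded sums and linear combinations\<close>

text \<open>By induction, each half is summed with error factor at most \<open>g\<close>, the factor
  of the longer half, and joining them contributes one more \<open>1 + \<epsilon>\<close>. Comparing
  with the sum of the norms makes the errors of the halves additive.\<close>

lemma pairwise_sum_error:
  fixes Xs :: "'a::real_normed_field mat list"
  assumes "pairwise_sum \<epsilon> m Xs S" and "0 \<le> \<epsilon>" and "\<forall>X\<in>set Xs. X \<in> carrier_mat m m"
  shows "S \<in> carrier_mat m m \<and> (\<forall>a<m. \<forall>b<m.
    norm (S $$ (a, b) - (\<Sum>X\<leftarrow>Xs. X $$ (a, b)))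
      \<le> ((1 + \<epsilon>) ^ ceil_log2 (length Xs) - 1) * (\<Sum>X\<leftarrow>Xs. norm (X $$ (a, b))))"
  using assms(1,3)
proof (induction rule: pairwise_sum.induct)
  case (split Xs Y Z S)
  let ?h = "(length Xs + 1) div 2"
  define T D where "T = take ?h Xs" and "D = drop ?h Xs"
  define g where "g = (1 + \<epsilon>) ^ ceil_log2 ?h"
  have g1: "1 \<le> g" unfolding g_def using assms(2) by simp
  have carr: "\<forall>X\<in>set T. X \<in> carrier_mat m m" "\<forall>X\<in>set D. X \<in> carrier_mat m m"
    using split.prems by (auto simp: T_def D_def dest: in_set_takeD in_set_dropD)
  have Y: "Y \<in> carrier_mat m m" and Z: "Z \<in> carrier_mat m m"
    using split.IH carr unfolding T_def D_def by auto
  have S: "S \<in> carrier_mat m m"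
    using split.hyps(4) Y by (auto simp: rounded_add_def)
  \<comment> \<open>The second half is never the longer one, so the exponent of the first half
    serves for both.\<close>
  have "length T = ?h" "length D \<le> ?h" using split.hyps(1) by (auto simp: T_def D_def)
  then have gT: "(1 + \<epsilon>) ^ ceil_log2 (length T) \<le> g" and gD: "(1 + \<epsilon>) ^ ceil_log2 (length D) \<le> g"
    unfolding g_def using assms(2) by (auto intro!: power_increasing ceil_log2_mono)
  show ?case
  proof (intro conjI S allI impI)
    fix a b assume ab: "a < m" "b < m"
    let ?s = "\<lambda>Xs. \<Sum>X\<leftarrow>Xs. X $$ (a, b)" and ?n = "\<lambda>Xs. \<Sum>X\<leftarrow>Xs. norm (X $$ (a, b))"
    have n0: "0 \<le> ?n Xs" for Xs :: "'a mat list"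
      by (intro sum_list_nonneg) auto
    have ns: "norm (?s Xs) \<le> ?n Xs" for Xs :: "'a mat list"
      by (induction Xs) (auto intro: norm_triangle_le)
    have Xs: "Xs = T @ D" by (simp add: T_def D_def)
    have eT: "norm (Y $$ (a, b) - ?s T) \<le> (g - 1) * ?n T"
      using split.IH(1) carr(1) ab gT n0[of T] unfolding T_def[symmetric]
      by (meson diff_right_mono mult_right_mono order_trans)
    have eD: "norm (Z $$ (a, b) - ?s D) \<le> (g - 1) * ?n D"
      using split.IH(2) carr(2) ab gD n0[of D] unfolding D_def[symmetric]
      by (meson diff_right_mono mult_right_mono order_trans)
    have "norm ((Y $$ (a, b) + Z $$ (a, b)) - ?s Xs) \<le> (g - 1) * ?n Xs"
      using norm_triangle_mono[OF eT eD] by (simp add: Xs algebra_simps)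
    moreover have "norm (S $$ (a, b) - (Y $$ (a, b) + Z $$ (a, b)))
        \<le> (1 + \<epsilon> - 1) * norm (Y $$ (a, b) + Z $$ (a, b))"
      using split.hyps(4) Y ab by (auto simp: rounded_add_def intro: rounded_error)
    ultimately have "norm (S $$ (a, b) - ?s Xs) \<le> (g * (1 + \<epsilon>) - 1) * ?n Xs"
      using ns assms(2) by (intro rel_error_trans) auto
    also have "\<dots> \<le> ((1 + \<epsilon>) ^ ceil_log2 (length Xs) - 1) * ?n Xs"
    proof (intro mult_right_mono diff_right_mono n0)
      have "g * (1 + \<epsilon>) = (1 + \<epsilon>) ^ Suc (ceil_log2 ?h)" by (simp add: g_def)
      also have "\<dots> \<le> (1 + \<epsilon>) ^ ceil_log2 (length Xs)"
        using assms(2) split.hyps(1) by (intro power_increasing Suc_ceil_log2_half) auto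
      finally show "g * (1 + \<epsilon>) \<le> (1 + \<epsilon>) ^ ceil_log2 (length Xs)" .
    qed
    finally show "norm (S $$ (a, b) - ?s Xs) \<le> ((1 + \<epsilon>) ^ ceil_log2 (length Xs) - 1) * ?n Xs" .
  qed
\<comment> \<open>With at most one term no addition takes place: the error is zero, and so is the
  exponent.\<close>
qed (auto simp: ceil_log2_def)

text \<open>The \<open>Suc\<close> stands for the rounded multiplication by the coefficient that
  precedes the additions. Only nonzero coefficients count in the exponent, while the sums may run
  over all indices because the other terms vanish.\<close>

lemma rounded_lincomb_error:
  fixes X :: "nat \<Rightarrow> 'a::real_normed_field mat"
  assumes "rounded_lincomb \<epsilon> m q c X S" and "0 \<le> \<epsilon>" and "\<And>i. i < q \<Longrightarrow> X i \<in> carrier_mat m m"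
  shows "S \<in> carrier_mat m m"
    and "a < m \<Longrightarrow> b < m \<Longrightarrow> norm (S $$ (a, b) - (\<Sum>i<q. c i * X i $$ (a, b)))
      \<le> ((1 + \<epsilon>) ^ Suc (ceil_log2 (card {i. i < q \<and> c i \<noteq> 0})) - 1) *
        (\<Sum>i<q. norm (c i) * norm (X i $$ (a, b)))"
proof -
  define I where "I = filter (\<lambda>i. c i \<noteq> 0) [0..<q]"
  obtain Ts where Ts: "list_all2 (\<lambda>i T. T \<in> rounded_smult \<epsilon> (c i) (X i)) I Ts" "pairwise_sum \<epsilon> m Ts S"
    using assms(1) unfolding rounded_lincomb_def I_def by blast
  have I: "set I = {i. i < q \<and> c i \<noteq> 0}" "distinct I" by (auto simp: I_def)
  have len: "length Ts = card {i. i < q \<and> c i \<noteq> 0}"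
    using list_all2_lengthD[OF Ts(1)] I distinct_card by metis
  have nth: "Ts ! i \<in> rounded_smult \<epsilon> (c (I ! i)) (X (I ! i))" "I ! i < q" if "i < length Ts" for i
    using Ts(1) that I(1) nth_mem[of i I] by (auto simp: list_all2_conv_all_nth)
  have carr: "\<forall>T\<in>set Ts. T \<in> carrier_mat m m"
  proof
    fix T assume "T \<in> set Ts"
    then obtain i where "i < length Ts" "T = Ts ! i" by (auto simp: in_set_conv_nth)
    then show "T \<in> carrier_mat m m"
      using nth[of i] assms(3)[of "I ! i"] by (auto simp: rounded_smult_def)
  qed
  note err = pairwise_sum_error[OF Ts(2) assms(2) carr]
  then show "S \<in> carrier_mat m m" by blast
  assume ab: "a < m" "b < m"
  \<comment> \<open>The result type is left general, since this serves both for sums of scalars and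
    for sums of their norms.\<close>
  have sum_I: "(\<Sum>i\<leftarrow>I. f i) = (\<Sum>i<q. f i)" if "\<And>i. c i = 0 \<Longrightarrow> f i = 0"
    for f :: "nat \<Rightarrow> 'b::comm_monoid_add"
    unfolding sum_list_distinct_conv_sum_set[OF I(2)] I(1)
    by (rule sum.mono_neutral_left) (auto intro: that)
  let ?g = "(1 + \<epsilon>) ^ ceil_log2 (length Ts)"
  let ?n = "\<Sum>i<q. norm (c i) * norm (X i $$ (a, b))"
  have "length I = length Ts" using list_all2_lengthD[OF Ts(1)] .
  have smult_err: "norm (Ts ! i $$ (a, b) - c (I ! i) * X (I ! i) $$ (a, b))
      \<le> \<epsilon> * norm (c (I ! i) * X (I ! i) $$ (a, b))" if "i < length Ts" for i
    using nth[OF that] assms(3)[of "I ! i"] ab by (auto simp: rounded_smult_def intro: rounded_error)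
  have "norm ((\<Sum>T\<leftarrow>Ts. T $$ (a, b)) - (\<Sum>i\<leftarrow>I. c i * X i $$ (a, b))) \<le>
      \<epsilon> * (\<Sum>i\<leftarrow>I. norm (c i * X i $$ (a, b)))"
    using \<open>length I = length Ts\<close> smult_err
    by (auto simp: sum_list_sum_nth sum_subtractf[symmetric] sum_distrib_left intro!: sum_norm_le)
  then have e1: "norm ((\<Sum>T\<leftarrow>Ts. T $$ (a, b)) - (\<Sum>i<q. c i * X i $$ (a, b))) \<le> \<epsilon> * ?n"
    by (simp add: sum_I norm_mult)
  have "norm (Ts ! i $$ (a, b)) \<le> (1 + \<epsilon>) * norm (c (I ! i) * X (I ! i) $$ (a, b))"
    if "i < length Ts" for i
    by (rule norm_le_of_rel_error[OF _ order_refl]) (use smult_err[OF that] in simp)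
  then have "(\<Sum>T\<leftarrow>Ts. norm (T $$ (a, b))) \<le> (\<Sum>i\<leftarrow>I. (1 + \<epsilon>) * norm (c i * X i $$ (a, b)))"
    using \<open>length I = length Ts\<close> by (auto simp: sum_list_sum_nth intro!: sum_mono)
  also have "\<dots> = (1 + \<epsilon>) * ?n"
    by (simp add: sum_I norm_mult sum_distrib_left)
  finally have n: "(\<Sum>T\<leftarrow>Ts. norm (T $$ (a, b))) \<le> (1 + \<epsilon>) * ?n" .
  have "norm (S $$ (a, b) - (\<Sum>T\<leftarrow>Ts. T $$ (a, b))) \<le> (?g - 1) * (\<Sum>T\<leftarrow>Ts. norm (T $$ (a, b)))"
    using err ab by blast
  also have "\<dots> \<le> (?g - 1) * ((1 + \<epsilon>) * ?n)"
    using n assms(2) by (intro mult_left_mono) simp_all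
  \<comment> \<open>Summation error and multiplication error combine through \<open>(g - 1) * (1 +
    \<epsilon>) + \<epsilon> = g * (1 + \<epsilon>) - 1\<close>.\<close>
  finally have "norm ((S $$ (a, b) - (\<Sum>T\<leftarrow>Ts. T $$ (a, b))) +
      ((\<Sum>T\<leftarrow>Ts. T $$ (a, b)) - (\<Sum>i<q. c i * X i $$ (a, b)))) \<le>
      (?g - 1) * ((1 + \<epsilon>) * ?n) + \<epsilon> * ?n"
    using e1 by (rule norm_triangle_mono)
  then show "norm (S $$ (a, b) - (\<Sum>i<q. c i * X i $$ (a, b)))
      \<le> ((1 + \<epsilon>) ^ Suc (ceil_log2 (card {i. i < q \<and> c i \<noteq> 0})) - 1) * ?n"
    by (simp add: len[symmetric] algebra_simps)
qed

section \<open>Bounds and perturbations of exact products\<close>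

text \<open>Dropping the zero terms first gives the number of nonzero coefficients in place of
  \<open>q\<close>; this is the origin of the counts in \<open>e_row\<close>.\<close>

lemma sum_norm_coeff_le:
  fixes q :: nat and c x :: "nat \<Rightarrow> 'a::real_normed_field"
  assumes "\<And>i. i < q \<Longrightarrow> norm (c i) \<le> u" and "\<And>i. i < q \<Longrightarrow> norm (x i) \<le> r"
    and "0 \<le> r"
  shows "(\<Sum>i<q. norm (c i) * norm (x i)) \<le> real (card {i. i < q \<and> c i \<noteq> 0}) * u * r"
proof -
  have "(\<Sum>i<q. norm (c i) * norm (x i)) = (\<Sum>i | i < q \<and> c i \<noteq> 0. norm (c i) * norm (x i))"
    by (rule sum.mono_neutral_right) auto
  also have "\<dots> \<le> (\<Sum>i | i < q \<and> c i \<noteq> 0. u * r)"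
    using assms by (intro sum_mono mult_mono) (auto intro: order_trans[OF norm_ge_zero])
  finally show ?thesis by simp
qed

lemma mult_mat_entry:
  assumes "A \<in> carrier_mat m n" "B \<in> carrier_mat n l" "a < m" "b < l"
  shows "(A * B) $$ (a, b) = (\<Sum>q<n. A $$ (a, q) * B $$ (q, b))"
  using assms by (auto simp: scalar_prod_def atLeast0LessThan intro!: sum.cong)

lemma mult_mat_entry_bound:
  fixes A B :: "'a::real_normed_field mat"
  assumes "A \<in> carrier_mat m m" "B \<in> carrier_mat m m" "a < m" "b < m"
    and "\<And>i j. i < m \<Longrightarrow> j < m \<Longrightarrow> norm (A $$ (i, j)) \<le> x"
    and "\<And>i j. i < m \<Longrightarrow> j < m \<Longrightarrow> norm (B $$ (i, j)) \<le> y"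
  shows "norm ((A * B) $$ (a, b)) \<le> real m * (x * y)"
proof -
  have "norm ((A * B) $$ (a, b)) \<le> (\<Sum>q<m. x * y)"
    unfolding mult_mat_entry[OF assms(1-4)]
    using assms(3-) by (intro sum_norm_le) (auto simp: norm_mult intro!: mult_mono
        intro: order_trans[OF norm_ge_zero])
  then show ?thesis by simp
qed

text \<open>Telescoping writes \<open>A' * B' - A * B\<close> as
  \<open>(A' - A) * B' + A * (B' - B)\<close>. Entries of \<open>B'\<close> are at most
  \<open>h * y\<close>, and \<open>(g - 1) * h + (h - 1) = g * h - 1\<close>; the factor
  \<open>m\<close> counts the terms of an inner product.\<close>

lemma mult_mat_rel_error:
  fixes A B A' B' :: "'a::real_normed_field mat"
  assumes "A \<in> carrier_mat m m" "B \<in> carrier_mat m m" "A' \<in> carrier_mat m m" "B' \<in> carrier_mat m m"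
    and "a < m" "b < m" "1 \<le> g" "1 \<le> h"
    and A: "\<And>i j. i < m \<Longrightarrow> j < m \<Longrightarrow> norm (A $$ (i, j)) \<le> x"
    and B: "\<And>i j. i < m \<Longrightarrow> j < m \<Longrightarrow> norm (B $$ (i, j)) \<le> y"
    and A': "\<And>i j. i < m \<Longrightarrow> j < m \<Longrightarrow> norm (A' $$ (i, j) - A $$ (i, j)) \<le> (g - 1) * x"
    and B': "\<And>i j. i < m \<Longrightarrow> j < m \<Longrightarrow> norm (B' $$ (i, j) - B $$ (i, j)) \<le> (h - 1) * y"
  shows "norm ((A' * B') $$ (a, b) - (A * B) $$ (a, b)) \<le> (g * h - 1) * (real m * (x * y))"
proof -
  have xy: "0 \<le> x" "0 \<le> y"
    using A[of a a] B[of a a] assms(5) norm_ge_zero order_trans by blast+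
  have "norm (A' $$ (a, q) * B' $$ (q, b) - A $$ (a, q) * B $$ (q, b)) \<le> (g * h - 1) * (x * y)"
    if q: "q < m" for q
  proof -
    have "A' $$ (a, q) * B' $$ (q, b) - A $$ (a, q) * B $$ (q, b) =
      (A' $$ (a, q) - A $$ (a, q)) * B' $$ (q, b) + A $$ (a, q) * (B' $$ (q, b) - B $$ (q, b))"
      by (simp add: algebra_simps)
    also have "norm \<dots> \<le> ((g - 1) * x) * (h * y) + x * ((h - 1) * y)"
      using A[of a q] A'[of a q] B'[of q b] norm_le_of_rel_error[OF B'[of q b] B[of q b]]
        assms(5-8) q xy
      by (intro norm_triangle_mono) (auto simp: norm_mult intro!: mult_mono)
    finally show ?thesis by (simp add: algebra_simps)
  qed
  then have "norm ((A' * B') $$ (a, b) - (A * B) $$ (a, b)) \<le> (\<Sum>q<m. (g * h - 1) * (x * y))"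
    using assms(1-6) by (auto simp only: mult_mat_entry sum_subtractf[symmetric] lessThan_iff
        intro!: sum_norm_le)
  then show ?thesis by (simp add: algebra_simps)
qed

section \<open>Block decomposition of a product\<close>

lemma block_index_less:
  fixes h k m a :: nat
  assumes "h < k" "a < m"
  shows "h * m + a < k * m"
proof -
  have "h * m + a < Suc h * m" using assms by simp
  also have "\<dots> \<le> k * m" using assms by (intro mult_right_mono) auto
  finally show ?thesis .
qed

lemma block_carrier: "block m A h l \<in> carrier_mat m m"
  by (simp add: block_def)

text \<open>The inner index runs through \<open>k * m\<close> values, which are grouped into
  \<open>k\<close> runs of \<open>m\<close> consecutive ones, one for each pair of blocks.\<close>

lemma mult_mat_block_entry:
  fixes A B :: "'a::real_normed_field mat"
  assumes "A \<in> carrier_mat (k * m) (k * m)" "B \<in> carrier_mat (k * m) (k * m)"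
    and "h < k" "l < k" "a < m" "b < m"
  shows "(A * B) $$ (h * m + a, l * m + b) = (\<Sum>q<k. (block m A h q * block m B q l) $$ (a, b))"
proof -
  let ?f = "\<lambda>x. A $$ (h * m + a, x) * B $$ (x, l * m + b)"
  have "(A * B) $$ (h * m + a, l * m + b) = sum ?f {..<k * m}"
    by (rule mult_mat_entry[OF assms(1,2)]) (simp_all add: block_index_less assms)
  also have "\<dots> = (\<Sum>q<k. sum ?f {q * m..<q * m + m})"
    by (rule sum.nat_group[symmetric])
  also have "\<dots> = (\<Sum>q<k. \<Sum>i<m. ?f (q * m + i))"
    by (simp add: sum.atLeastLessThan_shift_0[of _ "_ * m"] atLeast0LessThan)
  also have "\<dots> = (\<Sum>q<k. (block m A h q * block m B q l) $$ (a, b))"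
    using assms(5,6) by (intro sum.cong refl)
      (simp add: mult_mat_entry[OF block_carrier block_carrier], simp add: block_def)
  finally show ?thesis .
qed

section \<open>Amplification by one bilinear algorithm\<close>

text \<open>This is the factor that one recursion level contributes to the product in
  \<open>stability_factor\<close>.\<close>

definition growth :: "'a::real_normed_field mat \<Rightarrow> 'a mat \<Rightarrow> 'a mat \<Rightarrow> real" where
  "growth U V W = real (emax U V W) * max_norm U * max_norm V * max_norm W"

text \<open>This collects the products that enter row \<open>r\<close> of the output. The factor
  \<open>c\<close> is the amplification of a single product: \<open>E\<close> for the recursive
  products, 1 in the evaluation on all-ones matrices.\<close>

lemma norm_row_sum_le_growth:
  assumes "U \<in> carrier_mat q t" "V \<in> carrier_mat q t" "W \<in> carrier_mat q t" "r < q" "0 < t"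
    and "0 \<le> c" "0 \<le> x" "0 \<le> y"
  shows "(\<Sum>s<t. norm (W $$ (r, s)) *
      (c * ((real (col_nnz U s) * max_norm U * x) * (real (col_nnz V s) * max_norm V * y))))
    \<le> growth U V W * c * x * y"
proof -
  \<comment> \<open>The maximum over an empty matrix is unspecified, so nonnegativity is read off
    the entry at \<open>(r, 0)\<close>.\<close>
  have u: "0 \<le> max_norm U" "0 \<le> max_norm V" "0 \<le> max_norm W"
    using norm_entry_le_max_norm[of r _ 0] norm_ge_zero order_trans assms
    by (metis carrier_matD)+
  let ?z = "max_norm U * max_norm V * max_norm W * c * x * y"
  have z: "0 \<le> ?z" using u assms(6-8) by simp
  have "(\<Sum>s<t. norm (W $$ (r, s)) *
      (c * ((real (col_nnz U s) * max_norm U * x) * (real (col_nnz V s) * max_norm V * y))))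
    \<le> (\<Sum>s<t. real (col_nnz U s * col_nnz V s * (if W $$ (r, s) \<noteq> 0 then 1 else 0)) * ?z)"
  proof (intro sum_mono)
    fix s assume "s \<in> {..<t}"
    then have "norm (W $$ (r, s)) \<le> max_norm W"
      using assms by (intro norm_entry_le_max_norm) auto
    \<comment> \<open>Keeping the indicator discards the products absent from row \<open>r\<close>,
      so that the sum becomes \<open>e_row\<close>.\<close>
    then have "norm (W $$ (r, s)) \<le> (if W $$ (r, s) \<noteq> 0 then 1 else 0) * max_norm W"
      by simp
    then have "norm (W $$ (r, s)) *
      (c * ((real (col_nnz U s) * max_norm U * x) * (real (col_nnz V s) * max_norm V * y)))
      \<le> ((if W $$ (r, s) \<noteq> 0 then 1 else 0) * max_norm W) *
      (c * ((real (col_nnz U s) * max_norm U * x) * (real (col_nnz V s) * max_norm V * y)))"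
      using u assms(6-8) by (intro mult_right_mono) auto
    then show "norm (W $$ (r, s)) *
      (c * ((real (col_nnz U s) * max_norm U * x) * (real (col_nnz V s) * max_norm V * y)))
      \<le> real (col_nnz U s * col_nnz V s * (if W $$ (r, s) \<noteq> 0 then 1 else 0)) * ?z"
      by (auto simp: mult_ac)
  qed
  also have "\<dots> = real (e_row U V W r) * ?z"
    using assms(3) by (simp add: e_row_def sum_distrib_right[symmetric])
  also have "\<dots> \<le> real (emax U V W) * ?z"
    using z assms(3,4) by (intro mult_right_mono) (auto simp: emax_def)
  finally show ?thesis by (simp add: growth_def mult_ac)
qed

lemma bilinear_noncomm_algorithm_entry:
  fixes X Y :: "nat \<Rightarrow> nat \<Rightarrow> 'a::real_normed_field mat"
  assumes "bilinear_noncomm_algorithm k t U V W"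
    and "\<And>h l. X h l \<in> carrier_mat m m" "\<And>h l. Y h l \<in> carrier_mat m m"
    and "h < k" "l < k" "a < m" "b < m"
  shows "(\<Sum>q<k. (X h q * Y q l) $$ (a, b)) = (\<Sum>s<t. W $$ (k * h + l, s) *
     (lincomb_mat m (k\<^sup>2) (\<lambda>i. U $$ (i, s)) (\<lambda>i. X (i mod k) (i div k)) *
      lincomb_mat m (k\<^sup>2) (\<lambda>i. V $$ (i, s)) (\<lambda>i. Y (i mod k) (i div k))) $$ (a, b))"
proof -
  let ?P = "\<lambda>s. lincomb_mat m (k\<^sup>2) (\<lambda>i. U $$ (i, s)) (\<lambda>i. X (i mod k) (i div k)) *
      lincomb_mat m (k\<^sup>2) (\<lambda>i. V $$ (i, s)) (\<lambda>i. Y (i mod k) (i div k))"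
  have "mat m m (\<lambda>e. \<Sum>q<k. (X h q * Y q l) $$ e) =
              lincomb_mat m t (\<lambda>s. W $$ (k * h + l, s)) ?P"
    using assms(1-5) unfolding bilinear_noncomm_algorithm_def Let_def by blast
  then have "mat m m (\<lambda>e. \<Sum>q<k. (X h q * Y q l) $$ e) $$ (a, b) =
              lincomb_mat m t (\<lambda>s. W $$ (k * h + l, s)) ?P $$ (a, b)" by (rule arg_cong)
  then show ?thesis using assms(6,7) by (simp add: lincomb_mat_def)
qed

lemma lincomb_mat_carrier: "lincomb_mat m q c X \<in> carrier_mat m m"
  by (simp add: lincomb_mat_def)

text \<open>The first bound, with norms inside the sum, controls the rounding error of a linear
  combination; the second controls its exact value.\<close>

lemma lincomb_mat_entry_bound:
  assumes "M \<in> carrier_mat q t" "s < t" "a < m" "b < m" "0 \<le> x"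
    and "\<And>i. i < q \<Longrightarrow> norm (X i $$ (a, b)) \<le> x"
  shows "(\<Sum>i<q. norm (M $$ (i, s)) * norm (X i $$ (a, b))) \<le> real (col_nnz M s) * max_norm M * x"
    and "norm (lincomb_mat m q (\<lambda>i. M $$ (i, s)) X $$ (a, b)) \<le> real (col_nnz M s) * max_norm M * x"
proof -
  show 1: "(\<Sum>i<q. norm (M $$ (i, s)) * norm (X i $$ (a, b))) \<le> real (col_nnz M s) * max_norm M * x"
    using sum_norm_coeff_le[of q "\<lambda>i. M $$ (i, s)" "max_norm M" "\<lambda>i. X i $$ (a, b)" x] assms
      norm_entry_le_max_norm[of _ M s] by (simp add: col_nnz_def)
  have "norm (lincomb_mat m q (\<lambda>i. M $$ (i, s)) X $$ (a, b)) \<le>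
      (\<Sum>i<q. norm (M $$ (i, s)) * norm (X i $$ (a, b)))"
    using assms by (auto simp: lincomb_mat_def norm_mult intro!: sum_norm_le)
  with 1 show "norm (lincomb_mat m q (\<lambda>i. M $$ (i, s)) X $$ (a, b)) \<le> real (col_nnz M s) * max_norm M * x"
    by linarith
qed

lemma bilinear_noncomm_algorithm_carrier:
  assumes "bilinear_noncomm_algorithm k t U V W"
  shows "U \<in> carrier_mat (k\<^sup>2) t" "V \<in> carrier_mat (k\<^sup>2) t" "W \<in> carrier_mat (k\<^sup>2) t"
  using assms unfolding bilinear_noncomm_algorithm_def by auto

text \<open>Both facts come from evaluating the algorithm on \<open>1 \<times> 1\<close> blocks that are all equal to one.\<close>

lemma bilinear_noncomm_algorithm_growth:
  fixes U V W :: "'a::real_normed_field mat"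
  assumes alg: "bilinear_noncomm_algorithm k t U V W" and "1 \<le> k"
  shows "0 < t" and "real k \<le> growth U V W"
proof -
  note carr = bilinear_noncomm_algorithm_carrier[OF alg]
  define X :: "nat \<Rightarrow> nat \<Rightarrow> 'a mat" where "X = (\<lambda>h l. mat 1 1 (\<lambda>_. 1))"
  have X: "X h l \<in> carrier_mat 1 1" "X h l $$ (0, 0) = 1" for h l
    by (simp_all add: X_def)
  let ?U = "\<lambda>s. lincomb_mat 1 (k\<^sup>2) (\<lambda>i. U $$ (i, s)) (\<lambda>i. X (i mod k) (i div k))"
  let ?V = "\<lambda>s. lincomb_mat 1 (k\<^sup>2) (\<lambda>i. V $$ (i, s)) (\<lambda>i. X (i mod k) (i div k))"
  \<comment> \<open>The product of two all-ones matrices of order \<open>k\<close> has all entries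
    equal to \<open>k\<close>.\<close>
  have "(\<Sum>q<k. (X 0 q * X q 0) $$ (0, 0)) = of_nat k"
    using X by (simp add: mult_mat_entry[OF X(1) X(1)])
  then have k: "(of_nat k :: 'a) = (\<Sum>s<t. W $$ (0, s) * (?U s * ?V s) $$ (0, 0))"
    using bilinear_noncomm_algorithm_entry[OF alg, of X 1 X 0 0 0 0] assms(2) X(1) by simp
  \<comment> \<open>For \<open>t = 0\<close> the sum is empty, whereas \<open>k\<close> is nonzero
    in characteristic zero.\<close>
  then have "t \<noteq> 0" using assms(2) by (intro notI) simp
  then show t: "0 < t" by simp
  have "real k = norm (\<Sum>s<t. W $$ (0, s) * (?U s * ?V s) $$ (0, 0))"
    unfolding k[symmetric] by simp
  also have "\<dots> \<le> (\<Sum>s<t. norm (W $$ (0, s)) *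
      (1 * ((real (col_nnz U s) * max_norm U * 1) * (real (col_nnz V s) * max_norm V * 1))))"
  proof (intro sum_norm_le)
    fix s assume "s \<in> {..<t}"
    then have "norm ((?U s * ?V s) $$ (0, 0)) \<le>
      real 1 * ((real (col_nnz U s) * max_norm U * 1) * (real (col_nnz V s) * max_norm V * 1))"
      using carr X by (intro mult_mat_entry_bound lincomb_mat_carrier lincomb_mat_entry_bound(2)) auto
    then show "norm (W $$ (0, s) * (?U s * ?V s) $$ (0, 0)) \<le> norm (W $$ (0, s)) *
      (1 * ((real (col_nnz U s) * max_norm U * 1) * (real (col_nnz V s) * max_norm V * 1)))"
      by (simp add: norm_mult mult_left_mono)
  qed
  also have "\<dots> \<le> growth U V W * 1 * 1 * 1"
    using t assms(2) by (intro norm_row_sum_le_growth[OF carr]) auto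
  finally show "real k \<le> growth U V W" by simp
qed

section \<open>Error of one recursion level\<close>

lemma level_ops_ge:
  assumes "r < dim_row W" "s < dim_col W"
  shows "ceil_log2 (col_nnz U s) + ceil_log2 (col_nnz V s) + ceil_log2 (row_nnz W r) + 3
    \<le> level_ops U V W"
  unfolding level_ops_def using assms by (intro Max_ge) (auto intro!: rev_image_eqI[of "(r, s)"])

text \<open>Four stages are composed: the combinations of blocks of \<open>A\<close> and of
  \<open>B\<close>, the recursive products, and the combination by a row of \<open>W\<close>.
  \<open>N\<close> and \<open>E\<close> are the exponent and the amplification of the deeper levels.
  The hypothesis \<open>rec\<close> admits arbitrary bounds because it is applied to the computed
  operands, whose bounds carry the rounding factors of their own stage.\<close>

lemma level_error:
  fixes A B C :: "'a::real_normed_field mat"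
  assumes alg: "bilinear_noncomm_algorithm k t U V W" and "0 \<le> \<epsilon>" and mE: "real m \<le> E"
    and A: "A \<in> carrier_mat (k * m) (k * m)" and B: "B \<in> carrier_mat (k * m) (k * m)"
    and Aa: "\<And>i j. i < k * m \<Longrightarrow> j < k * m \<Longrightarrow> norm (A $$ (i, j)) \<le> x"
    and Bb: "\<And>i j. i < k * m \<Longrightarrow> j < k * m \<Longrightarrow> norm (B $$ (i, j)) \<le> y"
    and L: "\<And>s. s < t \<Longrightarrow> rounded_lincomb \<epsilon> m (k\<^sup>2) (\<lambda>i. U $$ (i, s))
              (\<lambda>i. block m A (i mod k) (i div k)) (L s)"
    and R: "\<And>s. s < t \<Longrightarrow> rounded_lincomb \<epsilon> m (k\<^sup>2) (\<lambda>i. V $$ (i, s))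
              (\<lambda>i. block m B (i mod k) (i div k)) (R s)"
    and P: "\<And>s. s < t \<Longrightarrow> P s \<in> carrier_mat m m"
    and rec: "\<And>s x y a b. s < t \<Longrightarrow> (\<And>i j. i < m \<Longrightarrow> j < m \<Longrightarrow> norm (L s $$ (i, j)) \<le> x) \<Longrightarrow>
       (\<And>i j. i < m \<Longrightarrow> j < m \<Longrightarrow> norm (R s $$ (i, j)) \<le> y) \<Longrightarrow> a < m \<Longrightarrow> b < m \<Longrightarrow>
       norm (P s $$ (a, b) - (L s * R s) $$ (a, b)) \<le> ((1 + \<epsilon>) ^ N - 1) * E * x * y"
    and S: "rounded_lincomb \<epsilon> m t (\<lambda>s. W $$ (k * h + l, s)) P S"
    and hl: "h < k" "l < k" and ab: "a < m" "b < m"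
  shows "norm (S $$ (a, b) - (A * B) $$ (h * m + a, l * m + b))
    \<le> ((1 + \<epsilon>) ^ (level_ops U V W + N) - 1) * (growth U V W * E) * x * y"
proof -
  note carr = bilinear_noncomm_algorithm_carrier[OF alg]
  have t: "0 < t" using bilinear_noncomm_algorithm_growth(1)[OF alg] hl by simp
  have div: "i div k < k" if "i < k\<^sup>2" for i
    using that by (simp add: less_mult_imp_div_less power2_eq_square)
  have "k * h + l < k * h + k" using hl by simp
  also have "\<dots> = k * Suc h" by simp
  also have "\<dots> \<le> k * k" using hl by (intro mult_left_mono) auto
  finally have r: "k * h + l < k\<^sup>2" by (simp add: power2_eq_square)
  have E: "0 \<le> E" using mE by (meson of_nat_0_le_iff order_trans)
  have km: "0 < k * m" using hl ab by simp
  have xy: "0 \<le> x" "0 \<le> y"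
    using Aa[OF km km] Bb[OF km km] norm_ge_zero order_trans by blast+
  \<comment> \<open>\<open>L'\<close> and \<open>R'\<close> are the exact operands, with entries
    bounded by \<open>xs\<close> and \<open>ys\<close>; \<open>f\<close>, \<open>g\<close>,
    \<open>d\<close> and \<open>c\<close> are the error factors of the four stages.\<close>
  define L' where "L' = (\<lambda>s. lincomb_mat m (k\<^sup>2) (\<lambda>i. U $$ (i, s)) (\<lambda>i. block m A (i mod k) (i div k)))"
  define R' where "R' = (\<lambda>s. lincomb_mat m (k\<^sup>2) (\<lambda>i. V $$ (i, s)) (\<lambda>i. block m B (i mod k) (i div k)))"
  define xs where "xs = (\<lambda>s. real (col_nnz U s) * max_norm U * x)"
  define ys where "ys = (\<lambda>s. real (col_nnz V s) * max_norm V * y)"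
  define f where "f = (\<lambda>s. (1 + \<epsilon>) ^ Suc (ceil_log2 (col_nnz U s)))"
  define g where "g = (\<lambda>s. (1 + \<epsilon>) ^ Suc (ceil_log2 (col_nnz V s)))"
  define w where "w = (\<lambda>s. norm (W $$ (k * h + l, s)))"
  define c where "c = (1 + \<epsilon>) ^ Suc (ceil_log2 (row_nnz W (k * h + l)))"
  define d where "d = (1 + \<epsilon>) ^ N"
  define G where "G = (1 + \<epsilon>) ^ (level_ops U V W + N)"
  have ge1: "1 \<le> f s" "1 \<le> g s" "1 \<le> c" "1 \<le> d" for s
    using \<open>0 \<le> \<epsilon>\<close> unfolding f_def g_def c_def d_def by (intro one_le_power, simp)+
  have blockA: "norm (block m A (i mod k) (i div k) $$ (a, b)) \<le> x"
    and blockB: "norm (block m B (i mod k) (i div k) $$ (a, b)) \<le> y"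
    if "i < k\<^sup>2" "a < m" "b < m" for i a b
    using that div[of i] hl by (auto simp: block_def intro!: Aa Bb block_index_less)
  have L'_bound: "norm (L' s $$ (a, b)) \<le> xs s" and R'_bound: "norm (R' s $$ (a, b)) \<le> ys s"
    if "s < t" "a < m" "b < m" for s a b
    unfolding L'_def xs_def R'_def ys_def using that carr xy blockA blockB
    by (auto intro!: lincomb_mat_entry_bound(2))
  have LR': "L' s \<in> carrier_mat m m" "R' s \<in> carrier_mat m m" for s
    by (simp_all add: L'_def R'_def lincomb_mat_carrier)
  have LR: "L s \<in> carrier_mat m m" "R s \<in> carrier_mat m m" if "s < t" for s
    using that rounded_lincomb_error(1)[OF L \<open>0 \<le> \<epsilon>\<close>] rounded_lincomb_error(1)[OF R \<open>0 \<le> \<epsilon>\<close>]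
    by (auto simp: block_carrier)
  have L_err: "norm (L s $$ (a, b) - L' s $$ (a, b)) \<le> (f s - 1) * xs s"
    if s: "s < t" "a < m" "b < m" for s a b
  proof -
    have "norm (L s $$ (a, b) - L' s $$ (a, b)) \<le> (f s - 1) *
        (\<Sum>i<k\<^sup>2. norm (U $$ (i, s)) * norm (block m A (i mod k) (i div k) $$ (a, b)))"
      using rounded_lincomb_error(2)[OF L \<open>0 \<le> \<epsilon>\<close>, of s a b] s carr
      by (simp add: f_def L'_def col_nnz_def lincomb_mat_def block_carrier)
    also have "\<dots> \<le> (f s - 1) * xs s"
      unfolding xs_def using ge1 s carr xy blockA
      by (intro mult_left_mono lincomb_mat_entry_bound(1)) auto
    finally show ?thesis .
  qed
  have R_err: "norm (R s $$ (a, b) - R' s $$ (a, b)) \<le> (g s - 1) * ys s"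
    if s: "s < t" "a < m" "b < m" for s a b
  proof -
    have "norm (R s $$ (a, b) - R' s $$ (a, b)) \<le> (g s - 1) *
        (\<Sum>i<k\<^sup>2. norm (V $$ (i, s)) * norm (block m B (i mod k) (i div k) $$ (a, b)))"
      using rounded_lincomb_error(2)[OF R \<open>0 \<le> \<epsilon>\<close>, of s a b] s carr
      by (simp add: g_def R'_def col_nnz_def lincomb_mat_def block_carrier)
    also have "\<dots> \<le> (g s - 1) * ys s"
      unfolding ys_def using ge1 s carr xy blockB
      by (intro mult_left_mono lincomb_mat_entry_bound(1)) auto
    finally show ?thesis .
  qed
  have xsys: "0 \<le> xs s * ys s" if "s < t" for s
    using L'_bound[OF that ab] R'_bound[OF that ab] by (meson mult_nonneg_nonneg norm_ge_zero order_trans)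
  \<comment> \<open>Replacing \<open>m\<close> by \<open>E\<close> bounds the exact product by the
    same quantity against which the recursive error is measured.\<close>
  have P'_bound: "norm ((L' s * R' s) $$ (a, b)) \<le> E * (xs s * ys s)" if s: "s < t" for s
  proof -
    have "norm ((L' s * R' s) $$ (a, b)) \<le> real m * (xs s * ys s)"
      using LR' L'_bound R'_bound s ab by (intro mult_mat_entry_bound) auto
    also have "\<dots> \<le> E * (xs s * ys s)" using mE xsys[OF s] by (rule mult_right_mono)
    finally show ?thesis .
  qed
  \<comment> \<open>Passing through \<open>L s * R s\<close>, the exact product of the computed
    operands, separates the recursive error from that of the operands:
    \<open>(d - 1) * f * g + (f * g - 1) = d * f * g - 1\<close>.\<close>
  have P_err: "norm (P s $$ (a, b) - (L' s * R' s) $$ (a, b))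
      \<le> (d * (f s * g s) - 1) * (E * (xs s * ys s))" if s: "s < t" for s
  proof -
    have 1: "norm (P s $$ (a, b) - (L s * R s) $$ (a, b)) \<le> (d - 1) * E * (f s * xs s) * (g s * ys s)"
      unfolding d_def using s ab
      by (intro rec norm_le_of_rel_error[OF L_err L'_bound] norm_le_of_rel_error[OF R_err R'_bound]) auto
    have "norm ((L s * R s) $$ (a, b) - (L' s * R' s) $$ (a, b))
        \<le> (f s * g s - 1) * (real m * (xs s * ys s))"
      using LR' LR L'_bound R'_bound L_err R_err s ab ge1
      by (intro mult_mat_rel_error) auto
    also have "\<dots> \<le> (f s * g s - 1) * (E * (xs s * ys s))"
      using mE xsys[OF s] mult_mono[OF ge1(1)[of s] ge1(2)[of s]] order_trans[OF zero_le_one ge1(1)[of s]]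
      by (intro mult_left_mono mult_right_mono) auto
    finally have "norm ((P s $$ (a, b) - (L s * R s) $$ (a, b)) +
        ((L s * R s) $$ (a, b) - (L' s * R' s) $$ (a, b))) \<le>
        (d - 1) * E * (f s * xs s) * (g s * ys s) + (f s * g s - 1) * (E * (xs s * ys s))"
      by (rule norm_triangle_mono[OF 1])
    then show ?thesis by (simp add: algebra_simps)
  qed
  have exact: "(A * B) $$ (h * m + a, l * m + b) =
      (\<Sum>s<t. W $$ (k * h + l, s) * (L' s * R' s) $$ (a, b))"
    unfolding L'_def R'_def mult_mat_block_entry[OF A B hl ab]
    by (rule bilinear_noncomm_algorithm_entry[OF alg block_carrier block_carrier hl ab])
  \<comment> \<open>The output error splits into the rounding of the last combination and the exact
    combination of the errors in the products.\<close>
  have "norm (S $$ (a, b) - (\<Sum>s<t. W $$ (k * h + l, s) * P s $$ (a, b))) \<le>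
      (c - 1) * (\<Sum>s<t. w s * norm (P s $$ (a, b)))"
    using rounded_lincomb_error(2)[OF S \<open>0 \<le> \<epsilon>\<close> P, of a b] ab carr
    by (simp add: c_def w_def row_nnz_def)
  moreover have "norm ((\<Sum>s<t. W $$ (k * h + l, s) * P s $$ (a, b)) -
      (A * B) $$ (h * m + a, l * m + b)) \<le>
      (\<Sum>s<t. w s * norm (P s $$ (a, b) - (L' s * R' s) $$ (a, b)))"
    unfolding exact sum_subtractf[symmetric] right_diff_distrib[symmetric]
    by (intro sum_norm_le) (simp add: norm_mult w_def)
  ultimately have "norm (S $$ (a, b) - (A * B) $$ (h * m + a, l * m + b)) \<le>
      (c - 1) * (\<Sum>s<t. w s * norm (P s $$ (a, b))) +
      (\<Sum>s<t. w s * norm (P s $$ (a, b) - (L' s * R' s) $$ (a, b)))"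
    using norm_triangle_mono by fastforce
  also have "\<dots> = (\<Sum>s<t. w s *
      ((c - 1) * norm (P s $$ (a, b)) + norm (P s $$ (a, b) - (L' s * R' s) $$ (a, b))))"
    by (simp add: sum_distrib_left sum.distrib distrib_left mult_ac)
  also have "\<dots> \<le> (\<Sum>s<t. w s * ((G - 1) * (E * (xs s * ys s))))"
  proof (intro sum_mono mult_left_mono)
    fix s assume "s \<in> {..<t}"
    then have s: "s < t" by simp
    let ?z = "E * (xs s * ys s)"
    have "(c - 1) * norm (P s $$ (a, b)) + norm (P s $$ (a, b) - (L' s * R' s) $$ (a, b)) \<le>
       (c - 1) * (d * (f s * g s) * ?z) + (d * (f s * g s) - 1) * ?z"
      using ge1 by (intro add_mono mult_left_mono P_err[OF s]
          norm_le_of_rel_error[OF P_err[OF s] P'_bound[OF s]]) auto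
    also have "\<dots> = (c * d * f s * g s - 1) * ?z" by (simp add: algebra_simps)
    also have "\<dots> \<le> (G - 1) * ?z"
    proof (intro mult_right_mono diff_right_mono)
      \<comment> \<open>The \<open>Suc\<close> in each of \<open>c\<close>, \<open>f\<close> and
        \<open>g\<close>, due to the multiplications by coefficients, yields the 3 in
        \<open>level_ops\<close>.\<close>
      have "c * d * f s * g s = (1 + \<epsilon>) ^ (ceil_log2 (col_nnz U s) + ceil_log2 (col_nnz V s) +
          ceil_log2 (row_nnz W (k * h + l)) + 3 + N)"
        by (simp add: c_def d_def f_def g_def power_add numeral_3_eq_3)
      also have "\<dots> \<le> G"
        unfolding G_def using \<open>0 \<le> \<epsilon>\<close> r s carr level_ops_ge[of "k * h + l" W s U V]
        by (intro power_increasing add_right_mono) auto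
      finally show "c * d * f s * g s \<le> G" .
      show "0 \<le> ?z" using E xsys[OF s] by simp
    qed
    finally show "(c - 1) * norm (P s $$ (a, b)) + norm (P s $$ (a, b) - (L' s * R' s) $$ (a, b))
        \<le> (G - 1) * ?z" .
  qed (simp add: w_def)
  also have "\<dots> = (G - 1) * (\<Sum>s<t. w s * (E * (xs s * ys s)))"
    by (simp add: sum_distrib_left mult_ac)
  also have "\<dots> \<le> (G - 1) * (growth U V W * E * x * y)"
    unfolding w_def xs_def ys_def using \<open>0 \<le> \<epsilon>\<close> carr r t E xy
    by (intro mult_left_mono norm_row_sum_le_growth) (auto simp: G_def)
  finally show ?thesis by (simp add: G_def mult_ac)
qed

section \<open>Error of the whole recursion\<close>

text \<open>Induction over the execution. The bounds \<open>x\<close> and \<open>y\<close> are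
  quantified inside so that they can be enlarged for the computed operands. The carrier clause
  supplies the dimensions of the recursive products, which the rule \<open>level\<close> does not
  state.\<close>

lemma recursive_product_error:
  fixes A B C :: "'a::real_normed_field mat"
  assumes "recursive_product \<epsilon> p k t U V W j A B C" and "0 \<le> \<epsilon>" and "1 \<le> j"
    and k: "\<And>j. j \<in> {1..p} \<Longrightarrow> k j \<ge> 1"
    and alg: "\<And>j. j \<in> {1..p} \<Longrightarrow> bilinear_noncomm_algorithm (k j) (t j) (U j) (V j) (W j)"
  defines "n \<equiv> \<lambda>j. \<Prod>i=j..p. k i"
  shows "C \<in> carrier_mat (n j) (n j) \<and> (\<forall>x y a b.
    (\<forall>i<n j. \<forall>l<n j. norm (A $$ (i, l)) \<le> x) \<longrightarrow> (\<forall>i<n j. \<forall>l<n j. norm (B $$ (i, l)) \<le> y) \<longrightarrow>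
    a < n j \<longrightarrow> b < n j \<longrightarrow> norm (C $$ (a, b) - (A * B) $$ (a, b)) \<le>
    ((1 + \<epsilon>) ^ (1 + (\<Sum>i=j..p. level_ops (U i) (V i) (W i))) - 1) *
      (\<Prod>i=j..p. growth (U i) (V i) (W i)) * x * y)"
  using assms(1,3)
proof (induction rule: recursive_product.induct)
  case (scalar A B C)
  \<comment> \<open>The rounding of the scalar multiplication is the 1 in the exponent: at level
    \<open>Suc p\<close> the sum over the levels is empty and the product of the growth factors is
    one.\<close>
  have "norm (C $$ (0, 0) - A $$ (0, 0) * B $$ (0, 0)) \<le> \<epsilon> * (x * y)"
    if "norm (A $$ (0, 0)) \<le> x" "norm (B $$ (0, 0)) \<le> y" for x y
  proof -
    have "norm (C $$ (0, 0) - A $$ (0, 0) * B $$ (0, 0)) \<le> \<epsilon> * norm (A $$ (0, 0) * B $$ (0, 0))"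
      using scalar by (intro rounded_error)
    also have "\<dots> \<le> \<epsilon> * (x * y)"
      unfolding norm_mult using that \<open>0 \<le> \<epsilon>\<close>
      by (intro mult_left_mono mult_mono) (auto intro: order_trans[OF norm_ge_zero])
    finally show ?thesis .
  qed
  then show ?case
    using scalar mult_mat_entry[OF scalar(1,2), of 0 0] by (simp add: n_def mult.assoc)
next
  case (level j m A B C L R P)
  have j: "j \<in> {1..p}" using level.hyps(1) level.prems by simp
  define N where "N = 1 + (\<Sum>i=Suc j..p. level_ops (U i) (V i) (W i))"
  define E where "E = (\<Prod>i=Suc j..p. growth (U i) (V i) (W i))"
  have nm: "n (Suc j) = m" and nj: "n j = k j * m"
    using level.hyps(1,2) by (simp_all add: n_def prod.atLeast_Suc_atMost)
  have Nj: "1 + (\<Sum>i=j..p. level_ops (U i) (V i) (W i)) = level_ops (U j) (V j) (W j) + N"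
    using level.hyps(1) by (simp add: N_def sum.atLeast_Suc_atMost)
  have Ej: "(\<Prod>i=j..p. growth (U i) (V i) (W i)) = growth (U j) (V j) (W j) * E"
    using level.hyps(1) by (simp add: E_def prod.atLeast_Suc_atMost)
  \<comment> \<open>Both sides are products over the deeper levels, and each \<open>k i\<close> is
    at most the growth of its level.\<close>
  have mE: "real m \<le> E"
    unfolding level.hyps(2) E_def of_nat_prod using j
    by (intro prod_mono) (auto intro!: bilinear_noncomm_algorithm_growth(2)[OF alg k])
  have P: "P s \<in> carrier_mat m m"
    and rec: "\<And>x y a b. (\<And>i l. i < m \<Longrightarrow> l < m \<Longrightarrow> norm (L s $$ (i, l)) \<le> x) \<Longrightarrow>
      (\<And>i l. i < m \<Longrightarrow> l < m \<Longrightarrow> norm (R s $$ (i, l)) \<le> y) \<Longrightarrow> a < m \<Longrightarrow> b < m \<Longrightarrow>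
      norm (P s $$ (a, b) - (L s * R s) $$ (a, b)) \<le> ((1 + \<epsilon>) ^ N - 1) * E * x * y"
    if "s < t j" for s
    using level.IH that unfolding nm N_def E_def by simp_all
  show ?case
    unfolding nj Nj Ej
  proof (intro conjI level.hyps(5) allI impI)
    fix x y a b
    assume x: "\<forall>i<k j * m. \<forall>l<k j * m. norm (A $$ (i, l)) \<le> x"
      and y: "\<forall>i<k j * m. \<forall>l<k j * m. norm (B $$ (i, l)) \<le> y"
      and ab: "a < k j * m" "b < k j * m"
    have m: "0 < m" using ab by (cases m) auto
    \<comment> \<open>Division by \<open>m\<close> locates the entry \<open>(a, b)\<close>:
      quotients give the block, remainders the position in it.\<close>
    have d: "a div m < k j" "b div m < k j" "a mod m < m" "b mod m < m"
      using ab m by (simp_all add: less_mult_imp_div_less)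
    have "norm (block m C (a div m) (b div m) $$ (a mod m, b mod m)
        - (A * B) $$ (a div m * m + a mod m, b div m * m + b mod m))
      \<le> ((1 + \<epsilon>) ^ (level_ops (U j) (V j) (W j) + N) - 1) * (growth (U j) (V j) (W j) * E) * x * y"
      by (rule level_error[OF alg[OF j] \<open>0 \<le> \<epsilon>\<close> mE level.hyps(3,4) _ _ _ _ P rec _ d])
        (use x y d(1,2) level.hyps(6-) in blast)+
    then show "norm (C $$ (a, b) - (A * B) $$ (a, b))
      \<le> ((1 + \<epsilon>) ^ (level_ops (U j) (V j) (W j) + N) - 1) * (growth (U j) (V j) (W j) * E) * x * y"
      using d by (simp add: block_def)
  qed
qed

section \<open>Second-order remainder and the stability bound\<close>

lemma power_one_plus_remainder_bigo:
  "(\<lambda>\<epsilon>::real. ((1 + \<epsilon>) ^ N - 1 - real N * \<epsilon>) * c) \<in> O[at_right 0](\<lambda>\<epsilon>. \<epsilon>\<^sup>2)"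
proof -
  have "\<exists>M. \<forall>\<epsilon>\<in>{0..1::real}. \<bar>(1 + \<epsilon>) ^ N - 1 - real N * \<epsilon>\<bar> \<le> M * \<epsilon>\<^sup>2"
  proof (induction N)
    case (Suc N)
    then obtain M where M: "\<And>\<epsilon>. \<epsilon> \<in> {0..1::real} \<Longrightarrow> \<bar>(1 + \<epsilon>) ^ N - 1 - real N * \<epsilon>\<bar> \<le> M * \<epsilon>\<^sup>2"
      by blast
    have "\<bar>(1 + \<epsilon>) ^ Suc N - 1 - real (Suc N) * \<epsilon>\<bar> \<le> (2 * M + N) * \<epsilon>\<^sup>2" if e: "\<epsilon> \<in> {0..1}" for \<epsilon> :: real
    proof -
      \<comment> \<open>The remainder of order \<open>Suc N\<close> is \<open>1 + \<epsilon>\<close>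
        times that of order \<open>N\<close>, plus \<open>N * \<epsilon>\<^sup>2\<close>. As
        \<open>1 + \<epsilon>\<close> is at most 2 on the unit interval, the constant
        \<open>M\<close> becomes \<open>2 * M + N\<close>.\<close>
      have "(1 + \<epsilon>) ^ Suc N - 1 - real (Suc N) * \<epsilon> =
          (1 + \<epsilon>) * ((1 + \<epsilon>) ^ N - 1 - real N * \<epsilon>) + N * \<epsilon>\<^sup>2"
        by (simp add: algebra_simps power2_eq_square)
      also have "\<bar>\<dots>\<bar> \<le> (1 + \<epsilon>) * \<bar>(1 + \<epsilon>) ^ N - 1 - real N * \<epsilon>\<bar> + N * \<epsilon>\<^sup>2"
        using e by (intro order_trans[OF abs_triangle_ineq]) (simp add: abs_mult)
      also have "\<dots> \<le> 2 * (M * \<epsilon>\<^sup>2) + N * \<epsilon>\<^sup>2"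
        using M[OF e] e by (intro add_right_mono mult_mono) auto
      finally show ?thesis by (simp add: algebra_simps)
    qed
    then show ?case by blast
  qed (auto intro: exI[of _ 0])
  then obtain M where M: "\<And>\<epsilon>. \<epsilon> \<in> {0..1::real} \<Longrightarrow> \<bar>(1 + \<epsilon>) ^ N - 1 - real N * \<epsilon>\<bar> \<le> M * \<epsilon>\<^sup>2"
    by blast
  have "(\<lambda>\<epsilon>::real. (1 + \<epsilon>) ^ N - 1 - real N * \<epsilon>) \<in> O[at_right 0](\<lambda>\<epsilon>. \<epsilon>\<^sup>2)"
  proof (rule bigoI[of _ M])
    show "\<forall>\<^sub>F \<epsilon> in at_right 0. norm ((1 + \<epsilon>) ^ N - 1 - real N * \<epsilon>) \<le> M * norm (\<epsilon>\<^sup>2)"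
      using M by (auto simp: eventually_at_right[of 0 "1::real"] intro!: exI[of _ 1])
  qed
  then show ?thesis by simp
qed

theorem theorem3p4:
  fixes p n :: nat and k t :: "nat \<Rightarrow> nat"
    and U V W :: "nat \<Rightarrow> 'a::real_normed_field mat"
    and A B :: "'a mat"
  assumes "p \<ge> 1"
    and "\<And>j. j \<in> {1..p} \<Longrightarrow> k j \<ge> 1"
    and "\<And>j. j \<in> {1..p} \<Longrightarrow> bilinear_noncomm_algorithm (k j) (t j) (U j) (V j) (W j)"
    and "n = (\<Prod>j=1..p. k j)"
    and "A \<in> carrier_mat n n" and "B \<in> carrier_mat n n"
  shows "\<exists>R :: real \<Rightarrow> real. R \<in> O[at_right 0](\<lambda>\<epsilon>. \<epsilon>\<^sup>2) \<and>
    (\<forall>\<^sub>F \<epsilon> in at_right 0. \<forall>Ccomp. recursive_product \<epsilon> p k t U V W 1 A B Ccomp \<longrightarrow>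
       max_norm (Ccomp - A * B) \<le>
         stability_factor p U V W * \<epsilon> * max_norm A * max_norm B + R \<epsilon>)"
proof -
  define N where "N = 1 + (\<Sum>i=1..p. level_ops (U i) (V i) (W i))"
  define E where "E = (\<Prod>i=1..p. growth (U i) (V i) (W i))"
  \<comment> \<open>\<open>R\<close> is the exact bound minus its linear part. It depends only on
    \<open>\<epsilon>\<close> and the fixed data, hence it is uniform over all executions.\<close>
  define R where "R = (\<lambda>\<epsilon>::real. ((1 + \<epsilon>) ^ N - 1 - real N * \<epsilon>) * (E * max_norm A * max_norm B))"
  have SF: "stability_factor p U V W = real N * E"
    by (simp add: stability_factor_def N_def E_def growth_def)
  \<comment> \<open>Positivity of \<open>n\<close> guarantees an entry, without which
    \<open>max_norm\<close> is unspecified.\<close>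
  have "0 < n" unfolding assms(4) using assms(2) by (intro prod_pos) force
  have "max_norm (C - A * B) \<le> stability_factor p U V W * \<epsilon> * max_norm A * max_norm B + R \<epsilon>"
    if \<epsilon>: "0 < \<epsilon>" and C: "recursive_product \<epsilon> p k t U V W 1 A B C" for \<epsilon> C
  proof -
    have carr: "C \<in> carrier_mat n n" and
      err: "\<And>a b. a < n \<Longrightarrow> b < n \<Longrightarrow> norm (C $$ (a, b) - (A * B) $$ (a, b)) \<le>
        ((1 + \<epsilon>) ^ N - 1) * E * max_norm A * max_norm B"
      using recursive_product_error[OF C _ _ assms(2,3)] \<epsilon> assms(5,6)
        norm_entry_le_max_norm[of _ A] norm_entry_le_max_norm[of _ B]
      unfolding assms(4)[symmetric] N_def[symmetric] E_def[symmetric] by simp_all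
    have "max_norm (C - A * B) \<le> ((1 + \<epsilon>) ^ N - 1) * E * max_norm A * max_norm B"
      using \<open>0 < n\<close> carr assms(5,6) err by (intro max_norm_le) auto
    also have "\<dots> = stability_factor p U V W * \<epsilon> * max_norm A * max_norm B + R \<epsilon>"
      unfolding SF R_def by (simp add: algebra_simps)
    finally show ?thesis .
  qed
  moreover have "R \<in> O[at_right 0](\<lambda>\<epsilon>. \<epsilon>\<^sup>2)"
    unfolding R_def by (rule power_one_plus_remainder_bigo)
  ultimately show ?thesis
    using eventually_at_right_less[of "0::real"] by (intro exI[of _ R]) (auto elim!: eventually_mono)
qed

end
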